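(* For every $i\in\mathbb{Z}_4$, the following relation holds on every nonzero finite-dimensional $\square_q$-module $V$ (i.e. as an equality in $\mathrm{End}(V)$): $$\begin{aligned}\exp_q(\mathfrak{n}_{i,i+1})^{-1}x_{i+3}\exp_q(\mathfrak{n}_{i,i+1}) ={}& x_{i+3}-x_{i}^{-1}+\frac{q\,x_{i}x_{i+1}x_{i+3}}{q-q^{-1}}-\frac{x_ix_{i+3}x_{i+1}}{q(q-q^{-1})}\\&+\frac{q^3x_i^2x_{i+1}^2x_{i+3}}{(q-q^{-1})(q^2-q^{-2})}+\frac{q\,x_i^2x_{i+3}x_{i+1}^2}{(q-q^{-1})(q^2-q^{-2})}-\frac{q^2x_i^2x_{i+1}x_{i+3}x_{i+1}}{(q-q^{-1})^2}.\end{aligned}$$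
   Context: Let $\mathbb{F}$ be an algebraically closed field and let $0\ne q\in\mathbb{F}$ be not a root of unity. Algebras are associative with $1$. For $n\in\mathbb{Z}$, $[n]_q=(q^n-q^{-n})/(q-q^{-1})$; for $n\in\mathbb{N}=\{0,1,2,\dots\}$, $[n]_q^!=\prod_{k=1}^n[k]_q$ with $[0]_q^!=1$. Let $\mathbb{Z}_4=\mathbb{Z}/4\mathbb{Z}$; indices are taken in $\mathbb{Z}_4$. $\square_q$ is the $\mathbb{F}$-algebra with generators $\{x_i\}_{i\in\mathbb{Z}_4}$ and relations, for $i\in\mathbb{Z}_4$, $$\frac{qx_ix_{i+1}-q^{-1}x_{i+1}x_i}{q-q^{-1}}=1,\qquad x_i^3x_{i+2}-[3]_qx_i^2x_{i+2}x_i+[3]_qx_ix_{i+2}x_i^2-x_{i+2}x_i^3=0.$$ For $i\in\mathbb{Z}_4$ put $\mathfrak{n}_{i,i+1}=\dfrac{q(1-x_ix_{i+1})}{q-q^{-1}}=\dfrac{q^{-1}(1-x_{i+1}x_i)}{q-q^{-1}}\in\square_q$. On every nonzero finite-dimensional $\square_q$-module each $x_i$ acts invertibly, and $x_i^{-1}$ denotes the inverse of that action; each $\mathfrak{n}_{i,i+1}$ acts nilpotently. For a nilpotent $\psi\in\mathrm{End}(V)$, $V$ a nonzero finite-dimensional $\mathbb{F}$-vector space, $\exp_q(\psi)=\sum_{n\in\mathbb{N}}\frac{q^{\binom n2}}{[n]_q^!}\psi^n$, which is invertible. *)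

theory Defs
  imports
    "HOL-Library.Poly_Mapping"
    "HOL-Library.Numeral_Type"
    "HOL-Computational_Algebra.Polynomial"
    "HOL-Algebra.Module"
    "HOL-Algebra.QuotRing"
    "HOL-Algebra.Algebraic_Closure_Type"
begin

section \<open>$q$-integers and the $q$-exponential\<close>

definition q_int :: "'f::field \<Rightarrow> int \<Rightarrow> 'f" where
  "q_int q n = (q powi n - q powi (- n)) / (q - inverse q)"

definition q_fact :: "'f::field \<Rightarrow> nat \<Rightarrow> 'f" where
  "q_fact q n = (\<Prod>k=1..n. q_int q (int k))"

text \<open>
  \<^const>\<open>Sum_any\<close> sums over the (for nilpotent \<open>\<psi>\<close> finite) set of all \<open>n\<close> whose term is nonzero;
  the value is meaningful only for nilpotent \<open>\<psi>\<close>.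
\<close>

definition q_exp ::
  "('f::field \<Rightarrow> 'v::ab_group_add \<Rightarrow> 'v) \<Rightarrow> 'f \<Rightarrow> ('v \<Rightarrow> 'v) \<Rightarrow> 'v \<Rightarrow> 'v" where
  "q_exp scale q \<psi> v =
     Sum_any (\<lambda>n::nat. scale (q ^ (n choose 2) / q_fact q n) ((\<psi> ^^ n) v))"


section \<open>The free algebra on generators indexed by a type\<close>

text \<open>
  Words under concatenation, written additively: for a monoid \<open>M\<close> written additively, the product
  of \<^typ>\<open>'m \<Rightarrow>\<^sub>0 'f\<close> is the convolution product of the monoid algebra of \<open>M\<close>.
\<close>

datatype 'a free_monoid = Word (letters: "'a list")

instantiation free_monoid :: (type) monoid_add
begin

definition zero_free_monoid :: "'a free_monoid" where
  "0 = Word []"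

definition plus_free_monoid :: "'a free_monoid \<Rightarrow> 'a free_monoid \<Rightarrow> 'a free_monoid" where
  "u + v = Word (letters u @ letters v)"

instance
  by standard (simp_all add: zero_free_monoid_def plus_free_monoid_def)

end

type_synonym ('a, 'f) free_algebra = "'a free_monoid \<Rightarrow>\<^sub>0 'f"

definition free_gen :: "'a \<Rightarrow> ('a, 'f::field) free_algebra" where
  "free_gen i = Poly_Mapping.single (Word [i]) 1"

definition free_const :: "'f::field \<Rightarrow> ('a, 'f) free_algebra" where
  "free_const c = Poly_Mapping.single 0 c"


section \<open>The algebra $\square_q$\<close>

text \<open>
  The index set $\mathbb{Z}/4\mathbb{Z}$ is the numeral type \<^typ>\<open>4\<close>, whose arithmetic is modulo 4.
  Each relation $l = r$ is represented by $l - r$.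
\<close>

definition square_relators :: "'f::field \<Rightarrow> (4, 'f) free_algebra set" where
  "square_relators q =
     (\<Union>i::4. let x = (free_gen :: 4 \<Rightarrow> (4, 'f) free_algebra) in
       { free_const (inverse (q - inverse q)) *
           (free_const q * x i * x (i + 1) - free_const (inverse q) * x (i + 1) * x i) - 1,
         x i ^ 3 * x (i + 2)
           - free_const (q_int q 3) * x i ^ 2 * x (i + 2) * x i
           + free_const (q_int q 3) * x i * x (i + 2) * x i ^ 2
           - x (i + 2) * x i ^ 3 })"

definition square_ideal :: "'f::field \<Rightarrow> (4, 'f) free_algebra set" where
  "square_ideal q = genideal ring_of_type_algebra (square_relators q)"

definition square_class :: "'f::field \<Rightarrow> (4, 'f) free_algebra \<Rightarrow> (4, 'f) free_algebra set" where
  "square_class q a = a_r_coset ring_of_type_algebra (square_ideal q) a"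

text \<open>
  Although \<^const>\<open>genideal\<close> is mostly used for commutative rings, \<^locale>\<open>ideal\<close> means two-sided
  ideal. The record type \<^typ>\<open>('f, 'a) module\<close> provides the ring operations together with
  the scalar multiplication \<^const>\<open>smult\<close>.
\<close>

definition square_alg :: "'f::field \<Rightarrow> ('f, (4, 'f) free_algebra set) module" where
  "square_alg q = ring.extend (ring_of_type_algebra Quot square_ideal q)
     (module.fields
       (\<lambda>c a. square_class q (free_const c) \<otimes>\<^bsub>ring_of_type_algebra Quot square_ideal q\<^esub> a))"

definition square_gen :: "'f::field \<Rightarrow> 4 \<Rightarrow> (4, 'f) free_algebra set" where
  "square_gen q i = square_class q (free_gen i)"

text \<open>The element $\mathfrak{n}_{i,i+1} = q(1 - x_i x_{i+1})/(q - q^{-1})$ of $\square_q$.\<close>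

definition square_nil :: "'f::field \<Rightarrow> 4 \<Rightarrow> (4, 'f) free_algebra set" where
  "square_nil q i =
     (q / (q - inverse q)) \<odot>\<^bsub>square_alg q\<^esub>
       (\<one>\<^bsub>square_alg q\<^esub> \<ominus>\<^bsub>square_alg q\<^esub>
          square_gen q i \<otimes>\<^bsub>square_alg q\<^esub> square_gen q (i + 1))"


section \<open>Modules over an associative algebra\<close>

text \<open>
  The locale \<^locale>\<open>module\<close> requires a commutative ring of scalars, hence the following notion of a
  unital left module over an associative algebra \<open>A\<close> over a field \<open>'f\<close>, that is,
  an \<open>'f\<close>-algebra homomorphism from \<open>A\<close> to the endomorphisms of the vector space \<open>'v\<close>.
\<close>

locale algebra_module = vector_space scale
  for scale :: "'f::field \<Rightarrow> 'v::ab_group_add \<Rightarrow> 'v" +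
  fixes A :: "('f, 'a) module" (structure)
    and act :: "'a \<Rightarrow> 'v \<Rightarrow> 'v"
  assumes act_linear: "a \<in> carrier A \<Longrightarrow> Vector_Spaces.linear scale scale (act a)"
    and act_add: "a \<in> carrier A \<Longrightarrow> b \<in> carrier A \<Longrightarrow> act (a \<oplus> b) v = act a v + act b v"
    and act_smult: "a \<in> carrier A \<Longrightarrow> act (c \<odot> a) v = scale c (act a v)"
    and act_mult: "a \<in> carrier A \<Longrightarrow> b \<in> carrier A \<Longrightarrow> act (a \<otimes> b) v = act a (act b v)"
    and act_one: "act \<one> v = v"


section \<open>Basic facts about $\square_q$\<close>

lemma ring_ring_of_type_algebra: "ring (ring_of_type_algebra :: 'a::ring_1 ring)"
proof -
  have "\<exists>y. x + y = 0" for x :: 'a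
    by (rule exI[of _ "- x"]) simp
  then show ?thesis
    unfolding ring_of_type_algebra_def using add.right_inverse
    by unfold_locales (auto simp: algebra_simps Units_def)
qed

lemma ideal_square_ideal: "ideal (square_ideal q) ring_of_type_algebra"
  unfolding square_ideal_def
  by (rule ring.genideal_ideal[OF ring_ring_of_type_algebra])
     (simp add: ring_of_type_algebra_def)

lemma square_alg_simps:
  "carrier (square_alg q) = carrier (ring_of_type_algebra Quot square_ideal q)"
  "a \<otimes>\<^bsub>square_alg q\<^esub> b = a \<otimes>\<^bsub>ring_of_type_algebra Quot square_ideal q\<^esub> b"
  "one (square_alg q) = one (ring_of_type_algebra Quot square_ideal q)"
  "zero (square_alg q) = zero (ring_of_type_algebra Quot square_ideal q)"
  "add (square_alg q) = add (ring_of_type_algebra Quot square_ideal q)"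
  "c \<odot>\<^bsub>square_alg q\<^esub> a = square_class q (free_const c) \<otimes>\<^bsub>square_alg q\<^esub> a"
  by (simp_all add: square_alg_def ring.defs module.defs)

lemma carrier_square_alg: "carrier (square_alg q) = range (square_class q)"
  by (auto simp: square_alg_simps FactRing_def A_RCOSETS_def' square_class_def
      ring_of_type_algebra_def)

lemma ring_square_alg: "ring (square_alg q)"
proof -
  have "ring (ring_of_type_algebra Quot square_ideal q)"
    by (rule ideal.quotient_is_ring[OF ideal_square_ideal])
  then interpret Q: ring "ring_of_type_algebra Quot square_ideal q" .
  show ?thesis
    by (intro ringI abelian_groupI monoidI)
       (auto simp: square_alg_simps Q.a_ac Q.m_assoc Q.l_distr Q.r_distr
             intro!: Q.l_neg Q.a_inv_closed bexI[of _ "a_inv (ring_of_type_algebra Quot square_ideal q) _"])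
qed

lemma square_class_one: "square_class q 1 = \<one>\<^bsub>square_alg q\<^esub>"
  by (simp add: square_alg_simps FactRing_def square_class_def ring_of_type_algebra_def)

lemma square_class_add:
  "square_class q (a + b) = square_class q a \<oplus>\<^bsub>square_alg q\<^esub> square_class q b"
  using ring_hom_add[OF ideal.rcos_ring_hom[OF ideal_square_ideal[of q]], of a b]
  by (simp add: square_alg_simps square_class_def ring_of_type_algebra_def)

lemma square_class_mult:
  "square_class q (a * b) = square_class q a \<otimes>\<^bsub>square_alg q\<^esub> square_class q b"
  using ring_hom_mult[OF ideal.rcos_ring_hom[OF ideal_square_ideal[of q]], of a b]
  by (simp add: square_alg_simps square_class_def ring_of_type_algebra_def)

lemma square_class_smult:
  "square_class q (free_const c * a) = c \<odot>\<^bsub>square_alg q\<^esub> square_class q a"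
  by (simp add: square_class_mult square_alg_simps)

lemma square_class_relator:
  assumes "r \<in> square_relators q"
  shows "square_class q r = \<zero>\<^bsub>square_alg q\<^esub>"
proof -
  have "square_relators q \<subseteq> square_ideal q"
    unfolding square_ideal_def
    by (rule ring.genideal_self[OF ring_ring_of_type_algebra])
       (simp add: ring_of_type_algebra_def)
  then have r: "r \<in> square_ideal q" using assms by blast
  interpret ideal "square_ideal q" ring_of_type_algebra by (rule ideal_square_ideal)
  show ?thesis
    using r by (simp add: square_class_def square_alg_simps FactRing_def a_rcos_const)
qed

end

theory Submission
  imports Defs
begin

text \<open>
  Fix \<open>i\<close> and write \<open>x, y, w\<close> for the actions of $x_i, x_{i+1}, x_{i+3}$; put \<open>t = q\<^sup>-\<^sup>2\<close> and
  \<open>m = 1 - x y\<close>. The quadratic relations say that \<open>(x, y)\<close> and \<open>(w, x)\<close> satisfy the same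
  \<open>t\<close>-Weyl relation \<open>x y = t y x + (1 - t)\<close>. Consequently \<open>m\<close> commutes with \<open>x\<close> and \<open>y\<close> up to powers
  of \<open>t\<close>. The element $\mathfrak{n}_{i,i+1}$ is \<open>m / (1 - t)\<close>, and in terms of \<open>m\<close> its
  \<open>q\<close>-exponential is \<open>E = \<Sum>\<^sub>n m\<^sup>n / (t;t)\<^sub>n\<close>, where \<open>(t;t)\<^sub>n = (1 - t) \<cdots> (1 - t\<^sup>n)\<close>.

  The operator \<open>m\<close> is nilpotent: an eigenvector with eigenvalue \<open>c \<noteq> 0\<close> produces under \<open>x\<close> and \<open>y\<close>
  eigenvectors with eigenvalues \<open>c t\<^sup>-\<^sup>k\<close> and \<open>c t\<^sup>k\<close>; only finitely many of them are nonzero, and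
  where the two chains break off the Weyl relation forces \<open>c = t\<^sup>a\<close> with \<open>a > 0\<close> and
  \<open>c = t\<^sup>-\<^sup>b\<close> with \<open>b \<ge> 0\<close>. Thus \<open>E\<close> is a finite sum and injective, and \<open>x\<close> has the inverse
  \<open>y (1 + m + m\<^sup>2 + \<cdots>)\<close>.

  Conjugation by \<open>E\<close> is governed by the \<open>q\<close>-binomial theorem
  \<open>E\<^sup>-\<^sup>1 w E = \<Sum>\<^sub>k W\<^sub>k / (t;t)\<^sub>k\<close>, where \<open>W\<^sub>0 = w\<close> and \<open>W\<^sub>k\<^sub>+\<^sub>1 = W\<^sub>k m - t\<^sup>k m W\<^sub>k\<close>
  (lemma \<open>w_qexp\<close>). The cubic relations are about another family of iterated commutators,
  \<open>U\<^sub>0 = w\<close> and \<open>U\<^sub>k\<^sub>+\<^sub>1 = y U\<^sub>k - t\<^sup>1\<^sup>-\<^sup>k U\<^sub>k y\<close>: since \<open>L\<^sup>3 - [3] L\<^sup>2 R + [3] L R\<^sup>2 - R\<^sup>3\<close> equals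
  \<open>(L - t R) (L - R) (L - t\<^sup>-\<^sup>1 R)\<close>, the relation says exactly \<open>U\<^sub>3 = 0\<close>. The two families are
  linked by \<open>x\<^sup>k U\<^sub>k = W\<^sub>k + (t;t)\<^sub>k y m\<^sup>k\<^sup>-\<^sup>1\<close> for \<open>k \<ge> 1\<close> (lemma \<open>x_pow_y_comm\<close>). Substituting this
  in the expansion, the terms \<open>y m\<^sup>k\<^sup>-\<^sup>1\<close> add up to \<open>x\<^sup>-\<^sup>1\<close> and there remains
  \<open>E\<^sup>-\<^sup>1 w E = w - x\<^sup>-\<^sup>1 + x U\<^sub>1 / (1 - t) + x\<^sup>2 U\<^sub>2 / ((1 - t) (1 - t\<^sup>2))\<close>, which is the asserted
  formula with \<open>U\<^sub>1\<close> and \<open>U\<^sub>2\<close> written out.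
\<close>

section \<open>Linear operators and annihilating polynomials\<close>

locale linear_space = vector_space scale
  for scale :: "'a::field \<Rightarrow> 'b::ab_group_add \<Rightarrow> 'b"
begin

abbreviation lin :: "('b \<Rightarrow> 'b) \<Rightarrow> bool" where
  "lin f \<equiv> Vector_Spaces.linear scale scale f"

lemma lin_simps:
  fixes f :: "'b \<Rightarrow> 'b"
  assumes "lin f"
  shows "f (u + v) = f u + f v" "f (u - v) = f u - f v" "f 0 = 0"
    "f (scale c u) = scale c (f u)" "f (\<Sum>i\<in>I. g i) = (\<Sum>i\<in>I. f (g i))"
proof -
  interpret f: Vector_Spaces.linear scale scale f by fact
  show "f (u + v) = f u + f v" "f (u - v) = f u - f v" "f 0 = 0"
    "f (scale c u) = scale c (f u)" "f (\<Sum>i\<in>I. g i) = (\<Sum>i\<in>I. f (g i))"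
    by (simp_all add: f.add f.diff f.scale f.sum)
qed

lemma linI:
  fixes f :: "'b \<Rightarrow> 'b"
  assumes "\<And>u v. f (u + v) = f u + f v" "\<And>c u. f (scale c u) = scale c (f u)"
  shows "lin f"
  using assms vector_space_axioms by (simp add: Vector_Spaces.linear_iff)

lemma lin_injI:
  assumes "lin f" "\<And>v. f v = 0 \<Longrightarrow> v = 0" shows "inj f"
proof (rule injI)
  fix u v assume "f u = f v"
  then have "f (u - v) = 0" by (simp add: lin_simps[OF assms(1)])
  then show "u = v" using assms(2) by force
qed

lemma lin_id: "lin (\<lambda>v. v)"
  by (rule linI) simp_all

lemma lin_comp: "lin f \<Longrightarrow> lin g \<Longrightarrow> lin (\<lambda>v. f (g v))"
  by (rule linI) (simp_all add: lin_simps)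

lemma lin_funpow: "lin f \<Longrightarrow> lin (f ^^ n)"
  by (induction n) (auto simp: id_def comp_def intro: lin_id lin_comp)

lemma lin_diff: "lin f \<Longrightarrow> lin g \<Longrightarrow> lin (\<lambda>v. f v - g v)"
  by (rule linI) (simp_all add: lin_simps scale_right_diff_distrib algebra_simps)

lemma lin_scale: "lin f \<Longrightarrow> lin (\<lambda>v. scale c (f v))"
  by (rule linI) (simp_all add: lin_simps scale_right_distrib mult.commute)

lemma lin_sum: "(\<And>i. i \<in> I \<Longrightarrow> lin (f i)) \<Longrightarrow> lin (\<lambda>v. \<Sum>i\<in>I. f i v)"
  by (rule linI) (simp_all add: lin_simps sum.distrib scale_sum_right)

definition poly_operator :: "('b \<Rightarrow> 'b) \<Rightarrow> 'a poly \<Rightarrow> 'b \<Rightarrow> 'b" where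
  "poly_operator f p = fold_coeffs (\<lambda>a g v. scale a v + f (g v)) p (\<lambda>v. 0)"

lemma poly_operator_0 [simp]: "poly_operator f 0 v = 0"
  by (simp add: poly_operator_def)

lemma poly_operator_pCons:
  assumes "lin f"
  shows "poly_operator f (pCons a p) v = scale a v + f (poly_operator f p v)"
  by (cases "p = 0 \<and> a = 0") 
    (auto simp: poly_operator_def lin_simps[OF assms])

lemma lin_poly_operator:
  assumes "lin f" shows "lin (poly_operator f p)"
proof (induction p)
  case 0
  then show ?case by (intro linI) simp_all
next
  case (pCons a p)
  then show ?case
    by (intro linI)
      (simp_all add: poly_operator_pCons assms lin_simps[OF assms] lin_simps
        scale_right_distrib algebra_simps)
qed

lemma poly_operator_add:
  assumes "lin f"
  shows "poly_operator f (p + r) v = poly_operator f p v + poly_operator f r v"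
proof (induction p arbitrary: r)
  case (pCons a p)
  obtain b r' where r: "r = pCons b r'" by (cases r)
  show ?case
    by (simp add: r poly_operator_pCons assms pCons.IH lin_simps[OF assms] scale_left_distrib algebra_simps)
qed simp

lemma poly_operator_smult:
  assumes "lin f"
  shows "poly_operator f (smult c p) v = scale c (poly_operator f p v)"
  by (induction p) (simp_all add: poly_operator_pCons assms lin_simps[OF assms] scale_right_distrib)

lemma poly_operator_mult:
  assumes "lin f"
  shows "poly_operator f (p * r) v = poly_operator f p (poly_operator f r v)"
  by (induction p)
    (simp_all add: poly_operator_pCons assms lin_simps[OF assms] poly_operator_add poly_operator_smult)

lemma poly_operator_monom:
  assumes "lin f"
  shows "poly_operator f (monom c n) v = scale c ((f ^^ n) v)"
  by (induction n) (simp_all add: monom_0 monom_Suc poly_operator_pCons assms lin_simps[OF assms])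

lemma poly_operator_eigenvector:
  assumes "lin f" "f v = scale l v"
  shows "poly_operator f p v = scale (poly p l) v"
  by (induction p) (simp_all add: poly_operator_pCons assms lin_simps[OF assms(1)] scale_left_distrib mult.commute)

end

locale finite_dim_space = linear_space scale + finite_dimensional_vector_space scale Basis
  for scale :: "'a::field \<Rightarrow> 'b::ab_group_add \<Rightarrow> 'b" and Basis :: "'b set"
begin

text \<open>
  The vectors \<open>f\<^sup>n v\<close> with \<open>n \<le> dim V\<close> are one too many to be independent.
\<close>
lemma annihilating_poly_vector:
  assumes f: "lin f"
  shows "\<exists>p. p \<noteq> 0 \<and> poly_operator f p v = 0"
proof (cases "inj_on (\<lambda>n. (f ^^ n) v) {..dimension}")
  case True
  let ?g = "\<lambda>n. (f ^^ n) v"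
  have "card (?g ` {..dimension}) = Suc dimension"
    using True by (simp add: card_image)
  then have "dependent (?g ` {..dimension})"
    using independent_card_le_dim[of "?g ` {..dimension}" UNIV] by (auto simp: dimension_def)
  then obtain u where u: "\<exists>v\<in>?g ` {..dimension}. u v \<noteq> 0"
      and "(\<Sum>v\<in>?g ` {..dimension}. scale (u v) v) = 0"
    by (auto simp: dependent_finite)
  then have s: "(\<Sum>n\<le>dimension. scale (u (?g n)) (?g n)) = 0"
    by (simp add: sum.reindex[OF True])
  define p where "p = (\<Sum>n\<le>dimension. monom (u (?g n)) n)"
  have "poly_operator f (\<Sum>n\<in>I. monom (u (?g n)) n) v = (\<Sum>n\<in>I. scale (u (?g n)) (?g n))"
    if "finite I" for I
    using that by induction (simp_all add: poly_operator_add poly_operator_monom f)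
  then have "poly_operator f p v = 0" using s by (simp add: p_def)
  moreover have "coeff p n = u (?g n)" if "n \<le> dimension" for n
    using that by (simp add: p_def coeff_sum)
  then have "p \<noteq> 0" using u by force
  ultimately show ?thesis by blast
next
  case False
  then obtain i j where "i \<noteq> j" "(f ^^ i) v = (f ^^ j) v"
    by (auto simp: inj_on_def)
  then have "poly_operator f (monom 1 i + monom (-1) j) v = 0"
    and "coeff (monom 1 i + monom (-1) j) i \<noteq> (0::'a)"
    by (simp_all add: poly_operator_add poly_operator_monom f)
  then show ?thesis by (metis coeff_0)
qed

text \<open>
  The product of annihilators of the basis vectors annihilates all of them, because polynomials in
  \<open>f\<close> commute.
\<close>
lemma annihilating_poly:
  assumes f: "lin f"
  shows "\<exists>p. p \<noteq> 0 \<and> (\<forall>v. poly_operator f p v = 0)"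
proof -
  have "\<exists>p. p \<noteq> 0 \<and> (\<forall>v\<in>S. poly_operator f p v = 0)" if "finite S" for S
    using that
  proof induction
    case empty
    show ?case by (intro exI[of _ 1]) simp
  next
    case (insert b S)
    then obtain p r where "p \<noteq> 0" "\<forall>v\<in>S. poly_operator f p v = 0" "r \<noteq> 0" "poly_operator f r b = 0"
      using annihilating_poly_vector[OF f, of b] by blast
    then have "r * p \<noteq> 0"
      and "poly_operator f (p * r) b = 0" and "\<forall>v\<in>S. poly_operator f (r * p) v = 0"
      by (simp_all add: poly_operator_mult[OF f] lin_simps[OF lin_poly_operator[OF f]])
    then have "r * p \<noteq> 0 \<and> (\<forall>v\<in>insert b S. poly_operator f (r * p) v = 0)"
      by (simp add: mult.commute)
    then show ?case by blast
  qed
  from this[OF finite_Basis] obtain p where p: "p \<noteq> 0" "\<forall>v\<in>Basis. poly_operator f p v = 0" by blast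
  interpret L: Vector_Spaces.linear scale scale "poly_operator f p" by (rule lin_poly_operator[OF f])
  have "poly_operator f p v = 0" for v
    by (rule L.eq_0_on_span[where b = Basis]) (use p span_Basis in auto)
  then show ?thesis using p by blast
qed

end

text \<open>
  Split the annihilating polynomial into linear factors \<open>X - a\<close>. Those with \<open>a \<noteq> 0\<close> are injective
  on \<open>V\<close> and can be cancelled, which leaves a power of \<open>X\<close>. The factor \<open>X\<close> has to be moved past
  the remaining ones before the induction hypothesis applies, so the vector varies in the induction.
\<close>
lemma (in linear_space) poly_operator_nilpotent:
  fixes p :: "'a poly"
  assumes f: "lin f" and "p \<noteq> 0" "poly_operator f p v = 0"
    and closed: "\<And>p :: 'a poly. degree p > 0 \<Longrightarrow> \<exists>a. poly p a = 0"
    and inj: "\<And>c v. c \<noteq> 0 \<Longrightarrow> f v = scale c v \<Longrightarrow> v = 0"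
  shows "(f ^^ degree p) v = 0"
  using assms(2,3)
proof (induction "degree p" arbitrary: p v)
  case 0
  then obtain c where "p = [:c:]" by (metis degree_eq_zeroE)
  with 0 show ?case by (simp add: poly_operator_pCons f lin_simps[OF f])
next
  case (Suc n)
  then obtain a where "poly p a = 0" using closed[of p] by auto
  then obtain r where r: "p = [:- a, 1:] * r" by (auto simp: poly_eq_0_iff_dvd elim: dvdE)
  with Suc.prems(1) have "r \<noteq> 0" by auto
  with Suc.hyps(2) have n: "n = degree r" by (simp add: r degree_mult_eq del: mult_pCons_left)
  have p0: "poly_operator f ([:- a, 1:] * r) v = 0" using Suc.prems(2) r by simp
  show ?case
  proof (cases "a = 0")
    case True
    then have "poly_operator f (r * [:0, 1:]) v = 0" using p0
      by (simp add: mult.commute del: mult_pCons_left mult_pCons_right)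
    then have "poly_operator f r (f v) = 0"
      by (simp add: poly_operator_mult f poly_operator_pCons lin_simps[OF f] del: mult_pCons_left mult_pCons_right)
    from Suc.hyps(1)[OF n \<open>r \<noteq> 0\<close> this] show ?thesis
      by (simp add: Suc.hyps(2)[symmetric] n funpow_swap1)
  next
    case False
    from p0 have "f (poly_operator f r v) = scale a (poly_operator f r v)"
      by (simp add: poly_operator_mult f poly_operator_pCons lin_simps[OF f] del: mult_pCons_left mult_pCons_right)
    then have "poly_operator f r v = 0" using inj False by blast
    from Suc.hyps(1)[OF n \<open>r \<noteq> 0\<close> this] show ?thesis
      by (simp add: Suc.hyps(2)[symmetric] n lin_simps[OF f])
  qed
qed

section \<open>The \<open>t\<close>-Weyl relation\<close>

text \<open>
  In the application \<open>t = q\<^sup>-\<^sup>2\<close>, and the relation is $q x_i x_{i+1} - q^{-1} x_{i+1} x_i = q - q^{-1}$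
  divided by \<open>q\<close>. The pair \<open>(w, x)\<close> with $w = x_{i+3}$ satisfies it as well.
\<close>
locale weyl_pair = linear_space scale
  for scale :: "'f::field \<Rightarrow> 'v::ab_group_add \<Rightarrow> 'v" +
  fixes t :: 'f and x y :: "'v \<Rightarrow> 'v"
  assumes t_nonzero: "t \<noteq> 0"
    and t_not_root_of_unity: "n > 0 \<Longrightarrow> t ^ n \<noteq> 1"
    and lin_x: "lin x" and lin_y: "lin y"
    and weyl: "x (y v) = scale t (y (x v)) + scale (1 - t) v"
begin

definition m :: "'v \<Rightarrow> 'v" where
  "m v = v - x (y v)"

lemma lin_m: "lin m"
  unfolding m_def[abs_def] by (rule lin_diff[OF lin_id lin_comp[OF lin_x lin_y]])

lemmas lin_pair = lin_simps[OF lin_x] lin_simps[OF lin_y] lin_simps[OF lin_m]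
  lin_simps[OF lin_funpow[OF lin_x]] lin_simps[OF lin_funpow[OF lin_y]]
  lin_simps[OF lin_funpow[OF lin_m]]

lemma x_y: "x (y v) = v - m v"
  by (simp add: m_def)

lemma y_x: "y (x v) = v - scale (1 / t) (m v)"
proof -
  have "scale t (y (x v)) = scale t v - m v"
    using weyl[of v] by (simp add: m_def scale_left_diff_distrib algebra_simps)
  then have "scale (1 / t) (scale t (y (x v))) = scale (1 / t) (scale t v - m v)" by simp
  then show ?thesis using t_nonzero by (simp add: scale_right_diff_distrib)
qed

text \<open>
  The chain \<open>x\<^sup>k v\<close> of eigenvectors of \<open>m\<close> can end only at eigenvalue \<open>t\<close>. As \<open>t \<noteq> 0\<close>, this also
  makes \<open>x\<close> injective once \<open>m\<close> is known to be nilpotent.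
\<close>
lemma m_on_kernel_x:
  assumes "x v = 0" shows "m v = scale t v"
proof -
  have "v = scale (1 / t) (m v)" using y_x[of v] assms by (simp add: lin_pair)
  then have "scale t v = scale t (scale (1 / t) (m v))" by simp
  then show ?thesis using t_nonzero by simp
qed

lemma x_m: "x (m v) = scale t (m (x v))"
proof -
  have "m (x v) = scale (1 / t) (x (m v))"
    unfolding m_def[of "x v"] y_x by (simp add: lin_pair)
  then show ?thesis using t_nonzero by simp
qed

text \<open>Evaluate \<open>y x y\<close> both as \<open>(1 - m / t) y\<close> and as \<open>y (1 - m)\<close>; similarly for \<open>x y x\<close> in \<open>x_m\<close>.\<close>
lemma m_y: "m (y v) = scale t (y (m v))"
proof -
  have "y (m v) = scale (1 / t) (m (y v))"
    using y_x[of "y v"] by (simp add: m_def[of v] lin_pair)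
  then show ?thesis using t_nonzero by simp
qed

lemma m_x: "m (x v) = scale (1 / t) (x (m v))"
  using t_nonzero by (simp add: x_m)

lemma x_pow_m: "(x ^^ k) (m v) = scale (t ^ k) (m ((x ^^ k) v))"
  by (induction k arbitrary: v) (simp_all add: x_m lin_pair mult_ac)

lemma m_pow_y: "(m ^^ k) (y v) = scale (t ^ k) (y ((m ^^ k) v))"
  by (induction k arbitrary: v) (simp_all add: m_y lin_pair mult_ac)

lemma eigenvector_x_pow:
  assumes "m v = scale c v"
  shows "m ((x ^^ k) v) = scale (c / t ^ k) ((x ^^ k) v)"
  by (induction k) (simp_all add: assms m_x lin_pair)

lemma eigenvector_y_pow:
  assumes "m v = scale c v"
  shows "m ((y ^^ k) v) = scale (c * t ^ k) ((y ^^ k) v)"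
  by (induction k) (simp_all add: assms m_y lin_pair mult_ac)

lemma pow_t_inject:
  assumes "t ^ i = t ^ j" shows "i = j"
proof -
  have "\<not> i < j" if "t ^ i = t ^ j" for i j
  proof
    assume "i < j"
    then have "t ^ (j - i) = 1"
      using that t_nonzero by (simp add: power_diff)
    then show False using t_not_root_of_unity \<open>i < j\<close> by force
  qed
  from this[of i j] this[of j i] show ?thesis using assms by simp
qed

text \<open>The \<open>q\<close>-Pochhammer symbol \<open>(t;t)\<^sub>k\<close>.\<close>
fun qpoch :: "nat \<Rightarrow> 'f" where
  "qpoch 0 = 1"
| "qpoch (Suc k) = qpoch k * (1 - t ^ Suc k)"

lemma qpoch_nonzero: "qpoch k \<noteq> 0"
proof (induction k)
  case (Suc k)
  then show ?case using t_not_root_of_unity[of "Suc k"] by simp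
qed simp

end

section \<open>Nilpotency in finite dimension\<close>

locale finite_dim_weyl_pair = weyl_pair scale t x y + finite_dim_space scale Basis
  for scale :: "'f::alg_closed_field \<Rightarrow> 'v::ab_group_add \<Rightarrow> 'v" and t x y Basis
begin

text \<open>
  If no \<open>f\<^sup>k v\<close> vanished, the infinitely many eigenvalues \<open>l k\<close> of \<open>m\<close> would all be roots of one
  annihilating polynomial of \<open>m\<close>.
\<close>
lemma vanishing_power:
  assumes l: "\<And>k. m ((f ^^ k) v) = scale (l k) ((f ^^ k) v)" and "inj l" "v \<noteq> 0"
  obtains k where "(f ^^ k) v \<noteq> 0" "f ((f ^^ k) v) = 0"
proof -
  obtain p where p: "p \<noteq> 0" "\<And>v. poly_operator m p v = 0"
    using annihilating_poly[OF lin_m] by blast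
  have "\<exists>k. (f ^^ k) v = 0"
  proof (rule ccontr)
    assume "\<nexists>k. (f ^^ k) v = 0"
    then have "poly p (l k) = 0" for k
      using poly_operator_eigenvector[OF lin_m l, of p] p(2) by auto
    then have "range l \<subseteq> {c. poly p c = 0}" by auto
    then have "finite (range l)" using poly_roots_finite[OF p(1)] finite_subset by blast
    then show False using finite_imageD[OF _ \<open>inj l\<close>] by simp
  qed
  moreover define n where "n = (LEAST k. (f ^^ k) v = 0)"
  ultimately have n: "(f ^^ n) v = 0" by (auto intro: LeastI)
  then obtain k where k: "n = Suc k" using \<open>v \<noteq> 0\<close> by (cases n) auto
  then have "(f ^^ k) v \<noteq> 0" using not_less_Least[of k "\<lambda>k. (f ^^ k) v = 0"] by (simp add: n_def)
  then show ?thesis using that n k by simp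
qed

text \<open>
  The last nonzero \<open>x\<^sup>k v\<close> has eigenvalue \<open>c / t\<^sup>k\<close>, which must be \<open>t\<close>; the last nonzero \<open>y\<^sup>j v\<close> has
  eigenvalue \<open>c t\<^sup>j\<close>, which must be \<open>1\<close> because \<open>m = 1 - x y\<close>. Together \<open>t\<^sup>k\<^sup>+\<^sup>j\<^sup>+\<^sup>1 = 1\<close>.
\<close>
lemma m_no_nonzero_eigenvalue:
  assumes "c \<noteq> 0" "m v = scale c v"
  shows "v = 0"
proof (rule ccontr)
  assume "v \<noteq> 0"
  have "inj (\<lambda>k. c / t ^ k)" "inj (\<lambda>k. c * t ^ k)"
    using \<open>c \<noteq> 0\<close> t_nonzero pow_t_inject by (auto simp: inj_def field_simps)
  obtain k where k: "(x ^^ k) v \<noteq> 0" "x ((x ^^ k) v) = 0"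
    by (rule vanishing_power[OF eigenvector_x_pow[OF assms(2)] \<open>inj (\<lambda>k. c / t ^ k)\<close> \<open>v \<noteq> 0\<close>])
  have "m ((x ^^ k) v) = scale t ((x ^^ k) v)"
    by (rule m_on_kernel_x[OF k(2)])
  then have c: "c = t * t ^ k"
    using eigenvector_x_pow[OF assms(2), of k] k(1) t_nonzero by (auto simp: field_simps)
  obtain j where j: "(y ^^ j) v \<noteq> 0" "y ((y ^^ j) v) = 0"
    by (rule vanishing_power[OF eigenvector_y_pow[OF assms(2)] \<open>inj (\<lambda>k. c * t ^ k)\<close> \<open>v \<noteq> 0\<close>])
  have "m ((y ^^ j) v) = scale 1 ((y ^^ j) v)"
    using j(2) by (simp add: m_def lin_pair)
  then have "c * t ^ j = 1"
    using eigenvector_y_pow[OF assms(2), of j] j(1) scale_right_imp_eq by metis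
  then have "t ^ Suc (k + j) = 1" using c by (simp add: power_add mult_ac)
  then show False using t_not_root_of_unity by blast
qed

lemma m_nilpotent: "\<exists>d. \<forall>v. (m ^^ d) v = 0"
proof -
  obtain p where "p \<noteq> 0" "\<And>v. poly_operator m p v = 0"
    using annihilating_poly[OF lin_m] by blast
  then show ?thesis
    using poly_operator_nilpotent[OF lin_m] m_no_nonzero_eigenvalue alg_closed_imp_poly_has_root by blast
qed

end

section \<open>The \<open>q\<close>-exponential and the inverse of \<open>x\<close>\<close>

locale nilpotent_weyl_pair = weyl_pair scale t x y
  for scale :: "'f::field \<Rightarrow> 'v::ab_group_add \<Rightarrow> 'v" and t x y +
  fixes d :: nat
  assumes m_pow_d: "(m ^^ d) v = 0"
begin

lemma m_pow_eq_0:
  assumes "k \<ge> d" shows "(m ^^ k) v = 0"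
proof -
  have "k = (k - d) + d" using assms by simp
  then have "(m ^^ k) v = (m ^^ (k - d)) ((m ^^ d) v)"
    by (metis comp_apply funpow_add)
  then show ?thesis by (simp only: m_pow_d lin_pair)
qed

text \<open>
  Up to the scaling \<open>m / (1 - t)\<close> of the argument this is the \<open>q\<close>-exponential: a formal expansion of
  \<open>1 / ((1 - m) (1 - t m) (1 - t\<^sup>2 m) \<cdots>)\<close>.
\<close>
definition qexp :: "'v \<Rightarrow> 'v" where
  "qexp v = (\<Sum>n<d. scale (1 / qpoch n) ((m ^^ n) v))"

lemma lin_qexp: "lin qexp"
  unfolding qexp_def[abs_def] by (intro lin_sum lin_scale lin_funpow lin_m)

lemma qexp_eq: "k \<ge> d \<Longrightarrow> qexp v = (\<Sum>n<k. scale (1 / qpoch n) ((m ^^ n) v))"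
  unfolding qexp_def by (rule sum.mono_neutral_left) (auto simp: m_pow_eq_0)

text \<open>
  The constant term of \<open>qexp\<close> is \<open>1\<close>: if \<open>m\<^sup>k v\<close> is the last nonzero vector in the chain of \<open>v\<close>, then
  \<open>m\<^sup>k\<close> maps \<open>qexp v\<close> to \<open>m\<^sup>k v \<noteq> 0\<close>.
\<close>
lemma inj_qexp: "inj qexp"
proof -
  have "v = 0" if "qexp v = 0" for v
  proof (rule ccontr)
    assume "v \<noteq> 0"
    define n where "n = (LEAST k. (m ^^ k) v = 0)"
    have n: "(m ^^ n) v = 0" unfolding n_def by (rule LeastI[of "\<lambda>k. (m ^^ k) v = 0" d]) (rule m_pow_d)
    then obtain k where k: "n = Suc k" using \<open>v \<noteq> 0\<close> by (cases n) auto
    have k0: "(m ^^ k) v \<noteq> 0"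
      using not_less_Least[of k "\<lambda>k. (m ^^ k) v = 0"] k by (simp add: n_def)
    have vanish: "(m ^^ k) ((m ^^ Suc j) v) = 0" for j
    proof -
      have "(m ^^ k) ((m ^^ Suc j) v) = (m ^^ (k + Suc j)) v"
        unfolding funpow_add by simp
      also have "k + Suc j = j + n" using k by simp
      also have "(m ^^ (j + n)) v = (m ^^ j) ((m ^^ n) v)"
        unfolding funpow_add by simp
      finally show ?thesis using n by (simp only: lin_pair)
    qed
    have "(m ^^ k) (qexp v) = (\<Sum>j<Suc d. scale (1 / qpoch j) ((m ^^ k) ((m ^^ j) v)))"
      by (simp only: qexp_eq[of "Suc d"] lin_pair le_SucI order_refl)
    also have "\<dots> = (m ^^ k) v"
      by (simp only: sum.lessThan_Suc_shift vanish) simp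
    finally show False using that k0 by (simp add: lin_pair)
  qed
  then show ?thesis
    by (rule lin_injI[OF lin_qexp])
qed

text \<open>From \<open>x y = 1 - m\<close>, the inverse of \<open>x\<close> is \<open>y (1 - m)\<^sup>-\<^sup>1\<close>, a geometric series.\<close>
definition x_inv :: "'v \<Rightarrow> 'v" where
  "x_inv v = (\<Sum>j<d. y ((m ^^ j) v))"

lemma x_inv_eq: "k \<ge> d \<Longrightarrow> x_inv v = (\<Sum>j<k. y ((m ^^ j) v))"
  unfolding x_inv_def by (rule sum.mono_neutral_left) (auto simp: m_pow_eq_0 lin_pair)

lemma x_x_inv: "x (x_inv v) = v"
proof -
  have "x (x_inv v) = (\<Sum>j<d. (m ^^ j) v - (m ^^ Suc j) v)"
    by (simp add: x_inv_def lin_pair x_y)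
  also have "\<dots> = (m ^^ 0) v - (m ^^ d) v" by (rule sum_lessThan_telescope')
  finally show ?thesis by (simp add: m_pow_d)
qed

lemma inj_x: "inj x"
proof -
  have "v = 0" if "x v = 0" for v
  proof -
    have "m v = scale t v"
      by (rule m_on_kernel_x[OF that])
    then have "(m ^^ k) v = scale (t ^ k) v" for k
      by (induction k) (simp_all add: lin_pair mult.commute)
    from this[of d] show ?thesis using m_pow_d t_nonzero by simp
  qed
  then show ?thesis
    by (rule lin_injI[OF lin_x])
qed

lemma inv_x: "inv_into UNIV x v = x_inv v"
  by (rule inv_f_eq[OF inj_x x_x_inv])

end

section \<open>Two families of iterated \<open>q\<close>-commutators\<close>

locale weyl_triple = weyl_pair scale t x y
  for scale :: "'f::field \<Rightarrow> 'v::ab_group_add \<Rightarrow> 'v" and t x y +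
  fixes w :: "'v \<Rightarrow> 'v"
  assumes lin_w: "lin w"
    and w_x: "w (x v) = scale t (x (w v)) + scale (1 - t) v"
begin

text \<open>
  With \<open>L\<close> and \<open>R\<close> denoting left and right multiplication by \<open>m\<close>, this is
  \<open>(R - t\<^sup>k\<^sup>-\<^sup>1 L) \<cdots> (R - t L) (R - L)\<close> applied to \<open>w\<close>.
\<close>
fun m_comm :: "nat \<Rightarrow> 'v \<Rightarrow> 'v" where
  "m_comm 0 v = w v"
| "m_comm (Suc k) v = m_comm k (m v) - scale (t ^ k) (m (m_comm k v))"

text \<open>
  The weights \<open>t, 1, t\<^sup>-\<^sup>1, \<dots>\<close> are chosen such that the third commutator is the left side of the cubic
  relation between \<open>y\<close> and \<open>w\<close>.
\<close>
fun y_comm :: "nat \<Rightarrow> 'v \<Rightarrow> 'v" where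
  "y_comm 0 v = w v"
| "y_comm (Suc k) v = y (y_comm k v) - scale (t / t ^ k) (y_comm k (y v))"

lemma lin_m_comm: "lin (m_comm k)"
proof (induction k)
  case 0 then show ?case using lin_w by (simp add: ext)
next
  case (Suc k)
  have "lin (\<lambda>v. m_comm k (m v) - scale (t ^ k) (m (m_comm k v)))"
    by (intro lin_diff lin_comp[of "m_comm k" m] lin_scale lin_comp[of m "m_comm k"] lin_m Suc)
  then show ?case by (simp add: ext)
qed

lemma lin_y_comm: "lin (y_comm k)"
proof (induction k)
  case 0 then show ?case using lin_w by (simp add: ext)
next
  case (Suc k)
  have "lin (\<lambda>v. y (y_comm k v) - scale (t / t ^ k) (y_comm k (y v)))"
    by (intro lin_diff lin_comp[of "y_comm k" y] lin_scale lin_comp[of y "y_comm k"] lin_y Suc)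
  then show ?case by (simp add: ext)
qed

lemmas lin_comms = lin_simps[OF lin_w] lin_simps[OF lin_m_comm] lin_simps[OF lin_y_comm]

text \<open>
  Each \<open>m_comm k\<close> inherits from \<open>w\<close> a Weyl relation with \<open>x\<close>; the inhomogeneous term, a
  scalar for \<open>k = 0\<close>, picks up a factor \<open>m\<close> in every step.
\<close>
lemma x_m_comm:
  "x (m_comm k v) = scale (t ^ k / t) (m_comm k (x v)) + scale ((1 - 1 / t) * qpoch k) ((m ^^ k) v)"
proof (induction k arbitrary: v)
  case 0
  have "w (x v) - scale (1 - t) v = scale t (x (w v))" by (simp add: w_x)
  then have "x (w v) = scale (1 / t) (w (x v) - scale (1 - t) v)" using t_nonzero by simp
  also have "\<dots> = scale (1 / t) (w (x v)) + scale (1 - 1 / t) v"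
    using t_nonzero
    by (simp add: scale_right_diff_distrib scale_left_diff_distrib diff_divide_distrib)
  finally show ?case by simp
next
  case (Suc k)
  define a where "a = m_comm k (m (x v))"
  define b where "b = m (m_comm k (x v))"
  define c where "c = (m ^^ Suc k) v"
  have [simp]: "m ((m ^^ k) v) = c" "(m ^^ k) (m v) = c"
    by (simp_all add: c_def funpow_swap1)
  have "x (m_comm (Suc k) v) = x (m_comm k (m v)) - scale (t ^ Suc k) (m (x (m_comm k v)))"
    by (simp add: lin_pair x_m mult.commute)
  also have "\<dots> = scale (t ^ k) a + scale ((1 - 1 / t) * qpoch k) c
      - (scale (t ^ Suc k * (t ^ k / t)) b + scale (t ^ Suc k * ((1 - 1 / t) * qpoch k)) c)"
    using t_nonzero by (simp add: Suc lin_pair lin_comms x_m a_def b_def scale_right_distrib)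
  also have "\<dots> = scale (t ^ k) a - scale (t ^ k * t ^ k) b
      + (scale ((1 - 1 / t) * qpoch k) c - scale (t ^ Suc k * ((1 - 1 / t) * qpoch k)) c)"
    using t_nonzero by (simp add: algebra_simps)
  also have "\<dots> = scale (t ^ k) (a - scale (t ^ k) b) + scale ((1 - 1 / t) * qpoch (Suc k)) c"
    unfolding scale_left_diff_distrib[symmetric] by (simp add: scale_right_diff_distrib algebra_simps)
  finally have eq: "x (m_comm (Suc k) v)
      = scale (t ^ k) (a - scale (t ^ k) b) + scale ((1 - 1 / t) * qpoch (Suc k)) c" .
  have tk: "t ^ Suc k / t = t ^ k" using t_nonzero by simp
  show ?case using eq unfolding tk a_def b_def c_def m_comm.simps(2) .
qed

text \<open>The difference between the two families after clearing \<open>x\<close>: see \<open>x_pow_y_comm\<close> below.\<close>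
fun tail :: "nat \<Rightarrow> 'v \<Rightarrow> 'v" where
  "tail 0 v = 0"
| "tail (Suc k) v = scale (qpoch (Suc k)) (y ((m ^^ k) v))"

text \<open>
  The contribution of \<open>tail k\<close> to \<open>tail (k + 1)\<close> in the induction for \<open>x_pow_y_comm\<close>; it
  vanishes for \<open>k = 0\<close>. The rest comes from the inhomogeneous term in \<open>x_m_comm\<close>.
\<close>
lemma tail_step:
  "tail k v - scale (t ^ k) (m (tail k v)) - scale (t / t ^ k) (x (tail k (y v)))
   = scale (qpoch k * (t - t ^ Suc k)) (y ((m ^^ k) v))"
proof (cases k)
  case (Suc j)
  define a where "a = y ((m ^^ k) v)"
  have 1: "m (y ((m ^^ j) v)) = scale t a"
    by (simp add: a_def Suc m_y)
  have 2: "x (y ((m ^^ j) (y v))) = scale (t ^ j) (y ((m ^^ j) v)) - scale (t ^ k) a"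
    by (simp add: x_y m_pow_y lin_pair 1 Suc mult.commute scale_right_diff_distrib)
  define z where "z = y ((m ^^ j) v)"
  have Z: "tail k v = scale (qpoch k) z" "m (tail k v) = scale (qpoch k * t) a"
    "x (tail k (y v)) = scale (qpoch k * t ^ j) z - scale (qpoch k * t ^ k) a"
    using Suc 1 2 by (simp_all only: tail.simps lin_pair scale_scale scale_right_diff_distrib z_def)
  have c: "t / t ^ k * (qpoch k * t ^ j) = qpoch k" "t / t ^ k * (qpoch k * t ^ k) = qpoch k * t"
    using t_nonzero by (simp_all add: Suc)
  show ?thesis
    unfolding Z(2,3) unfolding Z(1) scale_right_diff_distrib scale_scale c a_def[symmetric]
    by (simp add: algebra_simps)
qed (simp add: lin_pair)

text \<open>
  Let \<open>U = y_comm k\<close>.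
  In \<open>x\<^sup>k\<^sup>+\<^sup>1 (y U - (t / t\<^sup>k) U y)\<close> the first summand is \<open>(1 - t\<^sup>k m) x\<^sup>k U\<close>, since \<open>x y = 1 - m\<close>.
  In the second, \<open>x\<^sup>k U\<close> is \<open>m_comm k + tail k\<close> by induction; \<open>x\<close> moves to the right through
  \<open>m_comm k\<close> by \<open>x_m_comm\<close>, meets \<open>y\<close> and becomes \<open>1 - m\<close>. The weight \<open>t / t\<^sup>k\<close> makes the two
  copies of \<open>m_comm k\<close> cancel, which leaves \<open>m_comm (k + 1)\<close>.
\<close>
lemma x_pow_y_comm: "(x ^^ k) (y_comm k v) = m_comm k v + tail k v"
proof (induction k arbitrary: v)
  case (Suc k)
  have "(x ^^ Suc k) (y_comm (Suc k) v)
      = (x ^^ k) (x (y (y_comm k v))) - scale (t / t ^ k) (x ((x ^^ k) (y_comm k (y v))))"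
    by (simp add: lin_pair funpow_swap1)
  also have "\<dots> = (m_comm k v + tail k v) - scale (t ^ k) (m (m_comm k v + tail k v))
      - scale (t / t ^ k) (x (m_comm k (y v) + tail k (y v)))"
    by (simp add: x_y lin_pair x_pow_m Suc)
  also have "\<dots> = (m_comm k v - scale (t ^ k) (m (m_comm k v)) - scale (t / t ^ k) (x (m_comm k (y v))))
     + (tail k v - scale (t ^ k) (m (tail k v)) - scale (t / t ^ k) (x (tail k (y v))))"
    by (simp add: lin_pair scale_right_distrib)
  also have "scale (t / t ^ k) (x (m_comm k (y v)))
      = m_comm k v - m_comm k (m v) - scale ((1 - t) * qpoch k) (y ((m ^^ k) v))"
  proof -
    have c: "t / t ^ k * (t ^ k / t) = 1"
      "t / t ^ k * ((1 - 1 / t) * qpoch k * t ^ k) = - ((1 - t) * qpoch k)"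
      using t_nonzero by (simp_all add: field_simps)
    show ?thesis
      unfolding x_m_comm x_y m_pow_y lin_comms scale_right_distrib scale_scale c by simp
  qed
  also note tail_step
  finally show ?case by (simp add: algebra_simps scale_left_diff_distrib)
qed simp

text \<open>
  This is the \<open>q\<close>-binomial theorem for the commuting operators \<open>L\<close> and \<open>R\<close> on \<open>w\<close>, divided by
  \<open>(t;t)\<^sub>n\<close>. The induction step is the Pascal rule
  \<open>(1 - t\<^sup>k) + t\<^sup>k (1 - t\<^sup>n\<^sup>+\<^sup>1\<^sup>-\<^sup>k) = 1 - t\<^sup>n\<^sup>+\<^sup>1\<close>.
\<close>
lemma w_m_pow:
  "scale (1 / qpoch n) (w ((m ^^ n) v))
   = (\<Sum>k\<le>n. scale (1 / (qpoch (n - k) * qpoch k)) ((m ^^ (n - k)) (m_comm k v)))"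
proof (induction n arbitrary: v)
  case (Suc n)
  define e where "e j = 1 / qpoch j" for j
  have e: "e j = e (Suc j) * (1 - t ^ Suc j)" for j
    using qpoch_nonzero[of "Suc j"] by (simp add: e_def)
  define b where "b k = (m ^^ (Suc n - k)) (m_comm k v)" for k
  have "scale (e n) (w ((m ^^ Suc n) v)) = scale (e n) (w ((m ^^ n) (m v)))"
    by (simp add: funpow_swap1)
  also have "\<dots> = (\<Sum>k\<le>n. scale (e (n - k) * e k) ((m ^^ (n - k)) (m_comm k (m v))))"
    using Suc[of "m v"] by (simp add: e_def)
  also have "\<dots> = (\<Sum>k\<le>n. scale (e (n - k) * e k) (b (Suc k)))
      + (\<Sum>k\<le>n. scale (e (n - k) * e k * t ^ k) (b k))"
    unfolding sum.distrib[symmetric]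
  proof (rule sum.cong[OF refl])
    fix k assume "k \<in> {..n}"
    then have "Suc n - k = Suc (n - k)" by auto
    then have "b k = (m ^^ (n - k)) (m (m_comm k v))" by (simp add: b_def funpow_swap1)
    moreover have "m_comm k (m v) = m_comm (Suc k) v + scale (t ^ k) (m (m_comm k v))" by simp
    ultimately show "scale (e (n - k) * e k) ((m ^^ (n - k)) (m_comm k (m v)))
        = scale (e (n - k) * e k) (b (Suc k)) + scale (e (n - k) * e k * t ^ k) (b k)"
      by (simp only: lin_pair scale_right_distrib scale_scale) (simp add: b_def)
  qed
  also have "(\<Sum>k\<le>n. scale (e (n - k) * e k) (b (Suc k)))
      = (\<Sum>k\<le>n. scale (e (Suc n - Suc k) * e (Suc k) * (1 - t ^ Suc k)) (b (Suc k)))"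
  proof (intro sum.cong refl)
    fix k
    show "scale (e (n - k) * e k) (b (Suc k))
        = scale (e (Suc n - Suc k) * e (Suc k) * (1 - t ^ Suc k)) (b (Suc k))"
      by (subst e[of k]) (simp only: diff_Suc_Suc mult.assoc)
  qed
  also have "\<dots> = (\<Sum>k\<le>Suc n. scale (e (Suc n - k) * e k * (1 - t ^ k)) (b k))"
    unfolding sum.atMost_Suc_shift by simp
  also have "(\<Sum>k\<le>n. scale (e (n - k) * e k * t ^ k) (b k))
      = (\<Sum>k\<le>n. scale (e (Suc n - k) * e k * (t ^ k - t ^ Suc n)) (b k))"
  proof (intro sum.cong refl arg_cong2[where f = scale])
    fix k assume "k \<in> {..n}"
    then have "Suc n - k = Suc (n - k)" "t ^ Suc n = t ^ k * t ^ Suc (n - k)"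
      by (auto simp flip: power_add)
    then show "e (n - k) * e k * t ^ k = e (Suc n - k) * e k * (t ^ k - t ^ Suc n)"
      by (simp only: e[of "n - k"]) (simp add: algebra_simps)
  qed
  also have "\<dots> = (\<Sum>k\<le>Suc n. scale (e (Suc n - k) * e k * (t ^ k - t ^ Suc n)) (b k))"
    by simp
  also have "(\<Sum>k\<le>Suc n. scale (e (Suc n - k) * e k * (1 - t ^ k)) (b k)) + \<dots>
      = scale (1 - t ^ Suc n) (\<Sum>k\<le>Suc n. scale (e (Suc n - k) * e k) (b k))"
    unfolding sum.distrib[symmetric] scale_sum_right scale_left_distrib[symmetric] scale_scale
    by (intro sum.cong refl arg_cong2[where f = scale]) (simp add: algebra_simps)
  finally have "scale (1 / (1 - t ^ Suc n)) (scale (e n) (w ((m ^^ Suc n) v)))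
      = scale (1 / (1 - t ^ Suc n)) (scale (1 - t ^ Suc n)
          (\<Sum>k\<le>Suc n. scale (e (Suc n - k) * e k) (b k)))"
    by simp
  moreover have "1 - t ^ Suc n \<noteq> 0" using t_not_root_of_unity[of "Suc n"] by simp
  moreover have "1 / (1 - t ^ Suc n) * e n = e (Suc n)"
    using \<open>1 - t ^ Suc n \<noteq> 0\<close> by (simp add: e_def del: power_Suc)
  ultimately have "scale (e (Suc n)) (w ((m ^^ Suc n) v))
      = (\<Sum>k\<le>Suc n. scale (e (Suc n - k) * e k) (b k))"
    by (simp del: power_Suc funpow.simps sum.atMost_Suc)
  then show ?case by (simp only: e_def b_def mult.commute times_divide_times_eq mult_1_left)
qed (simp)

end

section \<open>Conjugation by the \<open>q\<close>-exponential\<close>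

locale nilpotent_weyl_triple =
  weyl_triple scale t x y w + nilpotent_weyl_pair scale t x y d
  for scale :: "'f::field \<Rightarrow> 'v::ab_group_add \<Rightarrow> 'v" and t x y w d
begin

text \<open>
  Summing \<open>w_m_pow\<close> over \<open>n\<close> gives the Cauchy product of the series of \<open>qexp\<close> with that of the
  \<open>m_comm k\<close>; both are finite on \<open>v\<close>.
\<close>
lemma w_qexp:
  assumes "\<And>k. k \<ge> K \<Longrightarrow> m_comm k v = 0"
  shows "w (qexp v) = qexp (\<Sum>k<K. scale (1 / qpoch k) (m_comm k v))"
proof -
  define g where "g k j = scale (1 / (qpoch j * qpoch k)) ((m ^^ j) (m_comm k v))" for k j
  have "g k j = 0" if "k \<ge> K \<or> j \<ge> d" for k j
    using that assms m_pow_eq_0 by (auto simp: g_def lin_pair)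
  then have g: "k < K \<and> j < d" if "g k j \<noteq> 0" for k j
    using that by (meson linorder_not_le)
  have "w (qexp v) = (\<Sum>n<d + K. scale (1 / qpoch n) (w ((m ^^ n) v)))"
    by (simp add: qexp_eq[of "d + K"] lin_comms)
  also have "\<dots> = (\<Sum>n<d + K. \<Sum>k\<le>n. g k (n - k))"
    by (simp add: w_m_pow g_def)
  also have "\<dots> = (\<Sum>(k, j)\<in>{(k, j). k + j < d + K}. g k j)"
    by (rule sum.triangle_reindex[symmetric])
  also have "\<dots> = (\<Sum>(k, j)\<in>{..<K} \<times> {..<d}. g k j)"
  proof (rule sum.mono_neutral_right)
    show "finite {(k, j). k + j < d + K}"
      by (rule finite_subset[of _ "{..<d + K} \<times> {..<d + K}"]) auto
  qed (auto dest: g)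
  also have "\<dots> = qexp (\<Sum>k<K. scale (1 / qpoch k) (m_comm k v))"
    unfolding lin_simps[OF lin_qexp] unfolding sum.cartesian_product[symmetric] qexp_def
    by (simp add: g_def lin_pair scale_sum_right mult.commute)
  finally show ?thesis .
qed

text \<open>
  Replace \<open>m_comm\<close> by \<open>y_comm\<close> in \<open>w_qexp\<close>: the tails \<open>y m\<^sup>k\<close> add up to \<open>x\<^sup>-\<^sup>1\<close>. The expansion in
  \<open>m_comm\<close> stops only because \<open>m\<close> is nilpotent, the one in \<open>y_comm\<close> stops at a fixed place.
\<close>
lemma w_qexp_y_comm:
  assumes U: "\<And>k v. k \<ge> N \<Longrightarrow> y_comm (Suc k) v = 0"
  shows "w (qexp v) = qexp (w v - x_inv v
    + (\<Sum>k<N. scale (1 / qpoch (Suc k)) ((x ^^ Suc k) (y_comm (Suc k) v))))"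
proof -
  have W: "scale (1 / qpoch (Suc k)) (m_comm (Suc k) v)
      = scale (1 / qpoch (Suc k)) ((x ^^ Suc k) (y_comm (Suc k) v)) - y ((m ^^ k) v)" for k
    using qpoch_nonzero[of "Suc k"]
    by (simp only: x_pow_y_comm tail.simps scale_right_distrib scale_scale) simp
  have "m_comm k v = 0" if "k \<ge> Suc (d + N)" for k
  proof -
    obtain j where j: "k = Suc j" "j \<ge> d + N" using \<open>k \<ge> Suc (d + N)\<close> by (cases k) auto
    have "y_comm (Suc j) v = 0" "(m ^^ j) v = 0"
      by (auto intro!: U m_pow_eq_0 simp: j(2) order_trans[OF _ j(2)] simp del: y_comm.simps)
    then have "scale (1 / qpoch (Suc j)) (m_comm (Suc j) v) = 0"
      unfolding W by (simp only: lin_pair scale_zero_right diff_self)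
    then show ?thesis using j(1) qpoch_nonzero[of "Suc j"] by (simp del: m_comm.simps qpoch.simps)
  qed
  then have "w (qexp v) = qexp (\<Sum>k<Suc (d + N). scale (1 / qpoch k) (m_comm k v))"
    by (rule w_qexp)
  also have "(\<Sum>k<Suc (d + N). scale (1 / qpoch k) (m_comm k v))
      = w v + (\<Sum>k<d + N. scale (1 / qpoch (Suc k)) (m_comm (Suc k) v))"
    by (simp only: sum.lessThan_Suc_shift qpoch.simps(1) m_comm.simps(1)) simp
  also have "(\<Sum>k<d + N. scale (1 / qpoch (Suc k)) (m_comm (Suc k) v))
      = (\<Sum>k<d + N. scale (1 / qpoch (Suc k)) ((x ^^ Suc k) (y_comm (Suc k) v))) - x_inv v"
    unfolding W sum_subtractf by (simp add: x_inv_eq[of "d + N"])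
  also have "(\<Sum>k<d + N. scale (1 / qpoch (Suc k)) ((x ^^ Suc k) (y_comm (Suc k) v)))
      = (\<Sum>k<N. scale (1 / qpoch (Suc k)) ((x ^^ Suc k) (y_comm (Suc k) v)))"
    by (rule sum.mono_neutral_right) (auto simp: U lin_pair simp del: y_comm.simps)
  finally show ?thesis by (simp only: add_diff_eq diff_add_eq)
qed

text \<open>
  By their recursion all later \<open>y_comm k\<close> vanish with the third, so two terms of the sum remain.
  Injectivity of \<open>qexp\<close> then cancels it from \<open>w_qexp_y_comm\<close>.
\<close>
lemma conj_qexp:
  assumes serre: "\<And>v. y_comm 3 v = 0"
  shows "(inv_into UNIV qexp \<circ> w \<circ> qexp) v = w v - inv_into UNIV x v
    + scale (1 / (1 - t)) (x (y_comm 1 v)) + scale (1 / ((1 - t) * (1 - t ^ 2))) (x (x (y_comm 2 v)))"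
proof -
  have U: "y_comm (Suc k) v = 0" if "k \<ge> 2" for k v
    using that
  proof (induction k arbitrary: v rule: nat_induct_at_least)
    case base
    then show ?case using serre by (simp add: eval_nat_numeral)
  next
    case (Suc k)
    show ?case by (subst y_comm.simps) (simp add: Suc lin_pair del: y_comm.simps)
  qed
  have "w (qexp v) = qexp (w v - inv_into UNIV x v
    + scale (1 / (1 - t)) (x (y_comm 1 v)) + scale (1 / ((1 - t) * (1 - t ^ 2))) (x (x (y_comm 2 v))))"
    by (simp add: w_qexp_y_comm[of 2, OF U] inv_x numeral_2_eq_2 add.assoc)
  then show ?thesis by (simp add: inv_f_f[OF inj_qexp])
qed

end

section \<open>Modules over \<open>\<square>\<^sub>q\<close>\<close>

locale square_module = algebra_module scale "square_alg q" act
  for q :: "'f::field" and scale :: "'f \<Rightarrow> 'v::ab_group_add \<Rightarrow> 'v"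
    and act :: "(4, 'f) free_algebra set \<Rightarrow> 'v \<Rightarrow> 'v" +
  assumes q_nonzero: "q \<noteq> 0" and q_not_root_of_unity: "n > 0 \<Longrightarrow> q ^ n \<noteq> 1"
begin

sublocale linear_space scale ..

text \<open>
  Representing the free algebra on \<open>V\<close> lets the relations be read off without any computation in the
  quotient ring.
\<close>
definition rep :: "(4, 'f) free_algebra \<Rightarrow> 'v \<Rightarrow> 'v" where
  "rep a = act (square_class q a)"

abbreviation x :: "4 \<Rightarrow> 'v \<Rightarrow> 'v" where
  "x j \<equiv> act (square_gen q j)"

lemma class_in_carrier: "square_class q a \<in> carrier (square_alg q)"
  by (simp add: carrier_square_alg)

lemma lin_rep: "lin (rep a)"
  unfolding rep_def by (rule act_linear[OF class_in_carrier])

lemma lin_gen: "lin (x j)"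
  using lin_rep[of "free_gen j"] by (simp add: rep_def square_gen_def)

lemma rep_add: "rep (a + b) v = rep a v + rep b v"
  by (simp add: rep_def square_class_add act_add class_in_carrier)

lemma rep_mult: "rep (a * b) v = rep a (rep b v)"
  by (simp add: rep_def square_class_mult act_mult class_in_carrier)

lemma rep_one: "rep 1 v = v"
  by (simp add: rep_def square_class_one act_one)

lemma rep_const: "rep (free_const c) v = scale c v"
  using square_class_smult[of q c 1]
  by (simp add: rep_def act_smult class_in_carrier) (simp add: square_class_one act_one)

lemma rep_gen: "rep (free_gen j) v = x j v"
  by (simp add: rep_def square_gen_def)

lemma rep_diff: "rep (a - b) v = rep a v - rep b v"
  using rep_add[of "a - b" b v] by simp

lemmas rep_simps = rep_add rep_diff rep_mult rep_one rep_const rep_gen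

lemma rep_relator:
  assumes "r \<in> square_relators q" shows "rep r v = 0"
proof -
  interpret A: ring "square_alg q" by (rule ring_square_alg)
  have "square_class q (r + r) = square_class q r"
    using assms by (simp add: square_class_add square_class_relator)
  then have "rep (r + r) v = rep r v" by (simp add: rep_def)
  then show ?thesis by (simp add: rep_add)
qed

lemma q_diff_nonzero: "q - inverse q \<noteq> 0"
  using q_not_root_of_unity[of 2] q_nonzero by (auto simp: field_simps power2_eq_square)

lemma gen_weyl:
  "x j (x (j + 1) v) = scale (inverse (q ^ 2)) (x (j + 1) (x j v)) + scale (1 - inverse (q ^ 2)) v"
proof -
  let ?x = "free_gen :: 4 \<Rightarrow> (4, 'f) free_algebra"
  let ?r = "free_const (inverse (q - inverse q)) *
    (free_const q * ?x j * ?x (j + 1) - free_const (inverse q) * ?x (j + 1) * ?x j) - 1"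
  have "?r \<in> square_relators q"
    unfolding square_relators_def Let_def by blast
  from rep_relator[OF this, of v]
  have "scale (inverse (q - inverse q))
      (scale q (x j (x (j + 1) v)) - scale (inverse q) (x (j + 1) (x j v))) = v"
    by (simp add: rep_simps)
  then have "scale (q - inverse q) v = scale (q - inverse q) (scale (inverse (q - inverse q))
      (scale q (x j (x (j + 1) v)) - scale (inverse q) (x (j + 1) (x j v))))" by simp
  also have "\<dots> = scale q (x j (x (j + 1) v)) - scale (inverse q) (x (j + 1) (x j v))"
    using q_diff_nonzero by simp
  finally have "scale q (x j (x (j + 1) v))
      = scale (inverse q) (x (j + 1) (x j v)) + scale (q - inverse q) v"
    by simp
  then have "scale (inverse q) (scale q (x j (x (j + 1) v)))
      = scale (inverse q) (scale (inverse q) (x (j + 1) (x j v)) + scale (q - inverse q) v)"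
    by simp
  moreover have "inverse q * (q - inverse q) = 1 - inverse (q ^ 2)"
    using q_nonzero by (simp add: field_simps power2_eq_square)
  moreover have "inverse q * inverse q = inverse (q ^ 2)"
    by (simp add: power2_eq_square)
  ultimately show ?thesis
    using q_nonzero by (simp add: scale_right_distrib)
qed

lemma q_int_3: "q_int q 3 = 1 + inverse (q ^ 2) + q ^ 2"
  using q_diff_nonzero q_nonzero
  by (simp add: q_int_def power_int_minus field_simps power2_eq_square power3_eq_cube)

lemma gen_serre:
  "x j (x j (x j (x (j + 2) v))) - scale (q_int q 3) (x j (x j (x (j + 2) (x j v))))
    + scale (q_int q 3) (x j (x (j + 2) (x j (x j v)))) - x (j + 2) (x j (x j (x j v))) = 0"
proof -
  let ?x = "free_gen :: 4 \<Rightarrow> (4, 'f) free_algebra"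
  have "?x j ^ 3 * ?x (j + 2)
      - free_const (q_int q 3) * ?x j ^ 2 * ?x (j + 2) * ?x j
      + free_const (q_int q 3) * ?x j * ?x (j + 2) * ?x j ^ 2
      - ?x (j + 2) * ?x j ^ 3 \<in> square_relators q"
    unfolding square_relators_def Let_def by blast
  from rep_relator[OF this, of v] show ?thesis
    by (simp add: rep_simps power2_eq_square power3_eq_cube)
qed

lemma act_nil:
  "act (square_nil q i) v = scale (1 / (1 - inverse (q ^ 2))) (v - x i (x (i + 1) v))"
proof -
  let ?A = "square_alg q"
  let ?u = "square_gen q i \<otimes>\<^bsub>?A\<^esub> square_gen q (i + 1)"
  interpret A: ring ?A by (rule ring_square_alg)
  have u: "?u = square_class q (free_gen i * free_gen (i + 1))"
    by (simp add: square_class_mult square_gen_def)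
  have uc: "?u \<in> carrier ?A" "\<one>\<^bsub>?A\<^esub> \<in> carrier ?A"
    unfolding u using class_in_carrier by auto
  then have dc: "\<one>\<^bsub>?A\<^esub> \<ominus>\<^bsub>?A\<^esub> ?u \<in> carrier ?A" by simp
  have "(\<one>\<^bsub>?A\<^esub> \<ominus>\<^bsub>?A\<^esub> ?u) \<oplus>\<^bsub>?A\<^esub> ?u = \<one>\<^bsub>?A\<^esub>"
    using uc by algebra
  then have "act (\<one>\<^bsub>?A\<^esub> \<ominus>\<^bsub>?A\<^esub> ?u) v + act ?u v = v"
    using act_add[OF dc uc(1), of v] by (simp add: act_one)
  moreover have "act ?u v = x i (x (i + 1) v)"
    unfolding u using rep_mult[of "free_gen i" "free_gen (i + 1)" v]
    by (simp add: rep_gen rep_def) (simp add: square_gen_def)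
  ultimately have "act (\<one>\<^bsub>?A\<^esub> \<ominus>\<^bsub>?A\<^esub> ?u) v = v - x i (x (i + 1) v)"
    by (simp add: eq_diff_eq)
  moreover have "q / (q - inverse q) = 1 / (1 - inverse (q ^ 2))"
    using q_nonzero q_diff_nonzero by (simp add: field_simps power2_eq_square)
  ultimately show ?thesis
    by (simp only: square_nil_def act_smult[OF dc])
qed

end

section \<open>The conjugation formula\<close>

lemma four_shifts: "(i::4) + 3 + 1 = i" "(i::4) + 1 + 2 = i + 3"
  by (simp_all add: add.assoc)

text \<open>
  The coefficients of the \<open>q\<close>-exponential, rescaled from $\mathfrak{n}_{i,i+1}$ to \<open>m\<close>: the recursion
  for \<open>A\<close> is that of \<open>(t;t)\<^sub>n\<close>, and the power \<open>q ^ (n choose 2)\<close> turns the symmetric factors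
  \<open>q\<^sup>k - q\<^sup>-\<^sup>k\<close> of the \<open>q\<close>-factorial into \<open>1 - t\<^sup>k\<close>.
\<close>
lemma q_coefficient:
  fixes q :: "'f::field" and A :: "nat \<Rightarrow> 'f"
  assumes q: "q \<noteq> 0" "\<And>n::nat. n > 0 \<Longrightarrow> q ^ n \<noteq> 1"
    and A: "A 0 = 1" "\<And>k. A (Suc k) = A k * (1 - inverse (q ^ 2) ^ Suc k)"
  shows "q ^ (n choose 2) / q_fact q n * (1 / (1 - inverse (q ^ 2))) ^ n = 1 / A n"
proof (induction n)
  case 0
  then show ?case by (simp add: q_fact_def A numeral_2_eq_2)
next
  case (Suc n)
  let ?c = "1 / (1 - inverse (q ^ 2))"
  have nz: "q ^ Suc n * q ^ Suc n \<noteq> 1" "q * q \<noteq> 1"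
    using q(2)[of "Suc n + Suc n"] q(2)[of 2] unfolding power_add power2_eq_square by simp_all
  have "q_int q (int (Suc n)) = (q ^ Suc n - inverse (q ^ Suc n)) / (q - inverse q)"
    by (simp add: q_int_def power_int_minus power_int_of_nat flip: of_nat_Suc del: power_Suc of_nat_Suc)
  moreover define r where "r = q ^ n"
  ultimately have i: "q_int q (int (Suc n)) = (q * r - inverse (q * r)) / (q - inverse q)"
    by simp
  have "inverse (q ^ 2) ^ Suc n = inverse ((q * r) ^ 2)"
    by (simp add: r_def power_inverse power_mult_distrib mult.commute flip: power_mult)
  moreover have "r / ((q * r - inverse (q * r)) / (q - inverse q)) * ?c
      = 1 / (1 - inverse ((q * r) ^ 2))"
  proof -
    have diff: "a - inverse a = (a * a - 1) / a" "1 - inverse (a ^ 2) = (a * a - 1) / (a * a)"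
      if "a \<noteq> 0" for a :: 'f
      using that by (simp_all add: field_simps power2_eq_square)
    have "q * r \<noteq> 0" "q * r * (q * r) - 1 \<noteq> 0" "q * q - 1 \<noteq> 0"
      using nz q(1) by (simp_all add: r_def)
    then show ?thesis
      unfolding diff[OF q(1)] diff[OF \<open>q * r \<noteq> 0\<close>] by simp
  qed
  ultimately have "r / q_int q (int (Suc n)) * ?c = 1 / (1 - inverse (q ^ 2) ^ Suc n)"
    unfolding i by simp
  moreover have "q ^ (Suc n choose 2) = r * q ^ (n choose 2)"
    "q_fact q (Suc n) = q_fact q n * q_int q (int (Suc n))"
    by (simp_all add: numeral_2_eq_2 power_add r_def q_fact_def)
  then have "q ^ (Suc n choose 2) / q_fact q (Suc n) * ?c ^ Suc n
      = (q ^ (n choose 2) / q_fact q n * ?c ^ n) * (r / q_int q (int (Suc n)) * ?c)"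
    by (simp add: mult_ac)
  ultimately show ?case by (simp only: Suc A times_divide_times_eq mult_1_left)
qed

lemma q_rational_coefficients:
  fixes q :: "'f::field"
  assumes "q \<noteq> 0" "q ^ 2 \<noteq> 1" "q ^ 4 \<noteq> 1" and t: "t = inverse (q ^ 2)"
  shows "q / (q - inverse q) = 1 / (1 - t)"
    and "1 / (q * (q - inverse q)) = 1 / (1 - t) * t"
    and "q ^ 3 / ((q - inverse q) * (q ^ 2 - inverse (q ^ 2))) = 1 / ((1 - t) * (1 - t ^ 2))"
    and "q / ((q - inverse q) * (q ^ 2 - inverse (q ^ 2))) = 1 / ((1 - t) * (1 - t ^ 2)) * t"
    and "q ^ 2 / (q - inverse q) ^ 2 = 1 / ((1 - t) * (1 - t ^ 2)) * (1 + t)"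
proof -
  have p: "q ^ 2 = q * q" "q ^ 3 = q * q * q" "q ^ 4 = q * q * (q * q)" for q :: 'f
    by (simp_all add: power2_eq_square power3_eq_cube power4_eq_xxxx mult.assoc)
  have nz: "q * q - 1 \<noteq> 0" "q * q + 1 \<noteq> 0" 
    using assms(2,3) unfolding p by (auto simp: eq_neg_iff_add_eq_0[symmetric])
  have e: "q - inverse q = (q * q - 1) / q"
    "q ^ 2 - inverse (q ^ 2) = (q * q - 1) * (q * q + 1) / (q * q)"
    "1 - t = (q * q - 1) / (q * q)"
    "1 - t ^ 2 = (q * q - 1) * (q * q + 1) / (q * q * (q * q))"
    "1 + t = (q * q + 1) / (q * q)" "t = 1 / (q * q)"
    using \<open>q \<noteq> 0\<close> unfolding t p by (simp_all add: divide_simps) (simp_all add: algebra_simps)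
  show "q / (q - inverse q) = 1 / (1 - t)"
    and "1 / (q * (q - inverse q)) = 1 / (1 - t) * t"
    and "q ^ 3 / ((q - inverse q) * (q ^ 2 - inverse (q ^ 2))) = 1 / ((1 - t) * (1 - t ^ 2))"
    and "q / ((q - inverse q) * (q ^ 2 - inverse (q ^ 2))) = 1 / ((1 - t) * (1 - t ^ 2)) * t"
    and "q ^ 2 / (q - inverse q) ^ 2 = 1 / ((1 - t) * (1 - t ^ 2)) * (1 + t)"
    unfolding e(1-5) unfolding e(6) using \<open>q \<noteq> 0\<close> nz by (simp_all add: p)
qed

theorem theorem9p3:
  fixes q :: "'f::alg_closed_field"
    and scale :: "'f \<Rightarrow> 'v::ab_group_add \<Rightarrow> 'v"
    and Basis :: "'v set"
    and act :: "(4, 'f) free_algebra set \<Rightarrow> 'v \<Rightarrow> 'v"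
    and i :: 4
  assumes q_nonzero: "q \<noteq> 0"
    and q_not_root_of_unity: "\<And>n::nat. n > 0 \<Longrightarrow> q ^ n \<noteq> 1"
    and finite_dimensional: "finite_dimensional_vector_space scale Basis"
    and nonzero: "\<exists>v::'v. v \<noteq> 0"
    and is_module: "algebra_module scale (square_alg q) act"
  shows "let x = (\<lambda>j. act (square_gen q j));
             E = q_exp scale q (act (square_nil q i)) in
    inv_into UNIV E \<circ> x (i + 3) \<circ> E =
    (\<lambda>v. x (i + 3) v
       - inv_into UNIV (x i) v
       + scale (q / (q - inverse q)) (x i (x (i + 1) (x (i + 3) v)))
       - scale (1 / (q * (q - inverse q))) (x i (x (i + 3) (x (i + 1) v)))
       + scale (q ^ 3 / ((q - inverse q) * (q ^ 2 - inverse (q ^ 2))))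
           (x i (x i (x (i + 1) (x (i + 1) (x (i + 3) v)))))
       + scale (q / ((q - inverse q) * (q ^ 2 - inverse (q ^ 2))))
           (x i (x i (x (i + 3) (x (i + 1) (x (i + 1) v)))))
       - scale (q ^ 2 / (q - inverse q) ^ 2)
           (x i (x i (x (i + 1) (x (i + 3) (x (i + 1) v))))))"
proof -
  interpret fd: finite_dimensional_vector_space scale Basis by (rule finite_dimensional)
  interpret M: square_module q scale act
    by (intro square_module.intro is_module square_module_axioms.intro q_nonzero q_not_root_of_unity)
  define t where "t = inverse (q ^ 2)"
  define x y w where "x = act (square_gen q i)" and "y = act (square_gen q (i + 1))"
    and "w = act (square_gen q (i + 3))"
  have t_root: "t ^ n \<noteq> 1" if "n > 0" for n
    using q_not_root_of_unity[of "2 * n"] that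
    by (simp add: t_def power_inverse flip: power_mult)
  have t_nonzero: "t \<noteq> 0" using q_nonzero by (simp add: t_def)
  have lin: "M.lin x" "M.lin y" "M.lin w"
    unfolding x_def y_def w_def by (rule M.lin_gen)+
  have xy: "x (y v) = scale t (y (x v)) + scale (1 - t) v" for v
    unfolding x_def y_def t_def by (rule M.gen_weyl)
  have wx: "w (x v) = scale t (x (w v)) + scale (1 - t) v" for v
    using M.gen_weyl[of "i + 3" v] unfolding x_def w_def t_def four_shifts .
  interpret W: weyl_pair scale t x y
    by (intro weyl_pair.intro weyl_pair_axioms.intro M.linear_space_axioms)
      (fact t_nonzero, erule t_root, fact lin(1), fact lin(2), rule xy)
  interpret F: finite_dim_weyl_pair scale t x y Basis ..
  obtain d where d: "\<And>v. (W.m ^^ d) v = 0" using F.m_nilpotent by blast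
  interpret N: nilpotent_weyl_triple scale t x y w d
    by (intro nilpotent_weyl_triple.intro weyl_triple.intro weyl_triple_axioms.intro
          nilpotent_weyl_pair.intro nilpotent_weyl_pair_axioms.intro W.weyl_pair_axioms)
      (fact lin(3), rule wx, rule d)
  note simps = W.lin_pair N.lin_comms
  \<comment> \<open>The weights \<open>t, 1, 1 / t\<close> of \<open>y_comm\<close> have elementary symmetric functions
      \<open>[3]\<^sub>q\<close>, \<open>[3]\<^sub>q\<close> and \<open>1\<close>.\<close>
  have serre: "N.y_comm 3 v = 0" for v
  proof -
    have "N.y_comm 3 v = y (y (y (w v))) - scale (1 + t + 1 / t) (y (y (w (y v))))
        + scale (1 + t + 1 / t) (y (w (y (y v)))) - w (y (y (y v)))"
      using t_nonzero
      by (simp add: numeral_3_eq_3 simps fd.scale_right_diff_distrib fd.scale_right_distrib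
          fd.scale_left_distrib power2_eq_square)
    also have "\<dots> = 0"
      using M.gen_serre[of "i + 1" v] M.q_int_3
      unfolding four_shifts x_def y_def w_def t_def by (simp add: divide_inverse)
    finally show ?thesis .
  qed
  have E: "q_exp scale q (act (square_nil q i)) = N.qexp"
  proof
    fix v
    have n: "act (square_nil q i) u = scale (1 / (1 - t)) (W.m u)" for u
      unfolding W.m_def unfolding M.act_nil x_def y_def t_def ..
    have nil: "(act (square_nil q i) ^^ n) v = scale ((1 / (1 - t)) ^ n) ((W.m ^^ n) v)" for n
      by (induction n) (simp_all add: n simps)
    have coefficient: "q ^ (n choose 2) / q_fact q n * (1 / (1 - t)) ^ n = 1 / W.qpoch n" for n
      by (rule q_coefficient[OF q_nonzero q_not_root_of_unity, folded t_def]) simp_all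
    have summand: "scale (q ^ (n choose 2) / q_fact q n) ((act (square_nil q i) ^^ n) v)
        = scale (1 / W.qpoch n) ((W.m ^^ n) v)" for n
      unfolding nil fd.scale_scale coefficient ..
    show "q_exp scale q (act (square_nil q i)) v = N.qexp v"
      unfolding q_exp_def summand N.qexp_def
      by (rule Sum_any.expand_superset) (use N.m_pow_eq_0 in \<open>auto simp: not_less[symmetric]\<close>)
  qed
  have "q ^ 2 \<noteq> 1" "q ^ 4 \<noteq> 1" using q_not_root_of_unity[of 2] q_not_root_of_unity[of 4] by simp_all
  note coeff = q_rational_coefficients[OF q_nonzero this t_def]
  have U: "N.y_comm 1 v = y (w v) - scale t (w (y v))"
    "N.y_comm 2 v = y (y (w v)) - scale (1 + t) (y (w (y v))) + scale t (w (y (y v)))" for v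
    using t_nonzero
    by (simp_all add: numeral_2_eq_2 simps fd.scale_right_diff_distrib fd.scale_left_distrib)
  show ?thesis
    unfolding Let_def E x_def[symmetric] y_def[symmetric] w_def[symmetric] coeff
    by (rule ext)
      (simp add: N.conj_qexp[OF serre, simplified comp_def] comp_def U simps
        fd.scale_right_diff_distrib fd.scale_right_distrib)
qed

end
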